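(* Let $V$ and $E$ be real reflexive Banach spaces, let $X$ be a real Banach space, let $f\in V^*$, and let $\Lambda\subset E$ be nonempty, closed and convex with $0_E\in\Lambda$. Let $A\colon V\to V^*$, $J\colon X\to\mathbb{R}$, $h\colon V\to\mathbb{R}$, $\gamma\colon V\to X$ and $b\colon V\times E\to\mathbb{R}$ satisfy the following hypotheses. On $A$: (A1) for all $w,v\in V$, $\limsup_{t\to0^+}\langle A(tw+(1-t)v),w-v\rangle\le\langle A(v),w-v\rangle$; (A2) $\langle A(u)+\gamma^*\xi_u-A(v)-\gamma^*\xi_v,u-v\rangle\ge h(u-v)$ for all $u,v\in V$, $\xi_u\in\partial J(\gamma u)$, $\xi_v\in\partial J(\gamma v)$; (A3) $\lim_{\|v\|_V\to+\infty}\frac{\langle A(v),v\rangle}{\|v\|_V^{\max\{\theta,1\}}}=+\infty$, where $\theta$ is the constant in (J2); (A4) $A$ maps bounded sets to bounded sets. On $J$: (J1) $J$ is locally Lipschitz continuous; (J2) there exist $\theta\ge0$, $\alpha_J\ge0$, $\beta_J>0$ such that $J^0(x;-x)\le\alpha_J+\beta_J\|x\|_X^\theta$ for all $x\in X$; (J3) $\partial J$ maps bounded subsets of $X$ into bounded subsets of $X^*$. On $h$: $h(0_V)=0$; (h1) $\limsup_{t\to0^+}\frac{h(tv)}{t}\ge0$ for all $v\in V$; (h2) whenever $v_n\to v$ weakly in $V$, $h(v)\le\limsup_{n\to\infty}h(v_n)$; (h3) $h(v)>0$ for all $v\in V\setminus\{0_V\}$. On $b$: $b$ is bilinear and bounded,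 and there is $\alpha_b>0$ with $\inf_{\rho\in E\setminus\{0_E\}}\sup_{v\in V\setminus\{0_V\}}\frac{b(v,\rho)}{\|v\|_V\|\rho\|_E}\ge\alpha_b$. On $\gamma$: $\gamma$ is linear and continuous. Then the problem of finding $(u,\lambda)\in V\times\Lambda$ such that $$\langle A(u),v-u\rangle+b(v-u,\lambda)+J^0(\gamma u;\gamma v-\gamma u)\ge\langle f,v-u\rangle\quad\text{for all }v\in V,$$ $$b(u,\rho-\lambda)\le0\quad\text{for all }\rho\in\Lambda,$$ has at least one solution, and the solution is unique in its first component: if $(u_1,\lambda_1)$ and $(u_2,\lambda_2)$ are both solutions, then $u_1=u_2$.
   Context: $\langle\cdot,\cdot\rangle$ is the duality pairing between $V^*$ and $V$, and $\gamma^*\colon X^*\to V^*$ is the adjoint of $\gamma$. For a locally Lipschitz function $J\colon X\to\mathbb{R}$, the generalized (Clarke) directional derivative at $x\in X$ in the direction $z\in X$ is $J^0(x;z)=\limsup_{t\to0^+,\,y\to x}\frac{J(y+tz)-J(y)}{t}$, and the generalized gradient is $\partial J(x)=\{\xi\in X^*\mid J^0(x;z)\ge\langle\xi,z\rangle_{X^*\times X}\text{ for all }z\in X\}$. A bilinear $b$ is bounded if $|b(v,\rho)|\le M\|v\|_V\|\rho\|_E$ for some $M\geq 0$ and all $v\in V$, $\rho\in E$. *)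

theory Defs
  imports "HOL-Analysis.Analysis"
begin

type_synonym 'a dual = "'a \<Rightarrow>\<^sub>L real"

(* blinfun.prod_left x is the evaluation functional \<phi> \<mapsto> \<phi> x, so this is surjectivity of the
   canonical embedding into the bidual. *)
definition reflexive_space :: "'a::real_normed_vector itself \<Rightarrow> bool" where
  "reflexive_space _ \<longleftrightarrow> surj (blinfun.prod_left :: 'a \<Rightarrow> 'a dual dual)"

definition weakly_tendsto :: "(nat \<Rightarrow> 'a::real_normed_vector) \<Rightarrow> 'a \<Rightarrow> bool" where
  "weakly_tendsto v l \<longleftrightarrow>
     (\<forall>\<phi>::'a dual. (\<lambda>n. blinfun_apply \<phi> (v n)) \<longlonglongrightarrow> blinfun_apply \<phi> l)"

definition dual_adjoint ::
  "('v::real_normed_vector \<Rightarrow>\<^sub>L 'x::real_normed_vector) \<Rightarrow> 'x dual \<Rightarrow> 'v dual" where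
  "dual_adjoint \<gamma> \<xi> = \<xi> o\<^sub>L \<gamma>"

definition locally_lipschitz :: "('x::metric_space \<Rightarrow> real) \<Rightarrow> bool" where
  "locally_lipschitz J \<longleftrightarrow> (\<forall>x. \<exists>r>0. \<exists>L. L-lipschitz_on (ball x r) J)"

(* The upper limit is taken in the extended reals; it is finite when J is locally Lipschitz.
   The point y may equal x, hence nhds x instead of at x. *)
definition clarke_deriv :: "('x::real_normed_vector \<Rightarrow> real) \<Rightarrow> 'x \<Rightarrow> 'x \<Rightarrow> ereal" where
  "clarke_deriv J x z =
     Limsup (at_right 0 \<times>\<^sub>F nhds x) (\<lambda>(t, y). ereal ((J (y + t *\<^sub>R z) - J y) / t))"

definition clarke_gradient :: "('x::real_normed_vector \<Rightarrow> real) \<Rightarrow> 'x \<Rightarrow> 'x dual set" where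
  "clarke_gradient J x = {\<xi>. \<forall>z. clarke_deriv J x z \<ge> ereal (blinfun_apply \<xi> z)}"

definition is_solution ::
  "('v::real_normed_vector \<Rightarrow> 'v dual) \<Rightarrow> ('v \<Rightarrow> 'e \<Rightarrow> real) \<Rightarrow>
   ('x::real_normed_vector \<Rightarrow> real) \<Rightarrow> ('v \<Rightarrow>\<^sub>L 'x) \<Rightarrow> 'v dual \<Rightarrow>
   'e::real_normed_vector set \<Rightarrow> 'v \<Rightarrow> 'e \<Rightarrow> bool" where
  "is_solution A b J \<gamma> f \<Lambda> u l \<longleftrightarrow>
     l \<in> \<Lambda> \<and>
     (\<forall>v. ereal (blinfun_apply (A u) (v - u) + b (v - u) l)
            + clarke_deriv J (blinfun_apply \<gamma> u) (blinfun_apply \<gamma> v - blinfun_apply \<gamma> u)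
          \<ge> ereal (blinfun_apply f (v - u))) \<and>
     (\<forall>\<rho>\<in>\<Lambda>. b u (\<rho> - l) \<le> 0)"

end

theory Submission
  imports Defs
begin

text \<open>On pairs in \<open>V \<times> \<Lambda>\<close> the problem is a variational inequality \<open>F p (q - p) \<ge> 0\<close> with \<open>F p\<close>
  sublinear, and by (A2) the bifunction is monotone. On a bounded closed convex set \<open>K\<close>, a point
  \<open>p\<close> with \<open>F q (p - q) \<le> 0\<close> for all \<open>q \<in> K\<close> is produced by a single application of
  the Hahn-Banach theorem on the dual space: reflexivity represents the resulting functional by a point,
  and monotonicity is what makes the dominating convex function vanish at the origin. Hemicontinuity
  (A1) and upper semicontinuity of the Clarke derivative turn \<open>p\<close> into a solution on \<open>K\<close>.
  Testing with the origin and using coercivity bounds the first component independently of \<open>K\<close>,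
  the inf-sup condition then bounds the multiplier, and so for a large ball \<open>K\<close> the solution is
  interior and the restriction to \<open>K\<close> can be dropped.\<close>

section \<open>Linear minorants of convex functions\<close>

lemma convex_on_minus_le:
  fixes q :: "'a::real_vector \<Rightarrow> real"
  assumes "convex_on UNIV q" and "q 0 = 0"
  shows "- q (- z) \<le> q z"
  using convex_onD[OF assms(1), of "1/2" z "- z"] assms(2) by simp

text \<open>For 0 < t < 1 the rescaling \<open>q (t *\<^sub>R x) / t\<close> and, for fixed
  \<open>y\<close>, the translate \<open>q (x + y) - q y\<close> are again convex and vanish at 0.
  Both lie below \<open>q\<close>, the second because homogeneity and midpoint convexity give
  subadditivity. Minimality turns these comparisons into homogeneity and additivity.\<close>

lemma linear_minimal_convex:
  fixes q :: "'a::real_vector \<Rightarrow> real"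
  assumes q: "convex_on UNIV q" "q 0 = 0"
    and minimal: "\<And>r. convex_on UNIV r \<Longrightarrow> r 0 = 0 \<Longrightarrow> (\<And>x. r x \<le> q x) \<Longrightarrow> r = q"
  shows "linear q"
proof -
  have hom_lt1: "q (t *\<^sub>R x) = t * q x" if t: "0 < t" "t < 1" for t x
  proof -
    have "(\<lambda>x. q (t *\<^sub>R x) / t) = q"
    proof (rule minimal)
      show "convex_on UNIV (\<lambda>x. q (t *\<^sub>R x) / t)"
      proof (rule convex_onI)
        fix s :: real and x y :: 'a
        assume s: "0 < s" "s < 1"
        have "q (t *\<^sub>R ((1 - s) *\<^sub>R x + s *\<^sub>R y)) = q ((1 - s) *\<^sub>R (t *\<^sub>R x) + s *\<^sub>R (t *\<^sub>R y))"
          by (simp add: algebra_simps)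
        also have "\<dots> \<le> (1 - s) * q (t *\<^sub>R x) + s * q (t *\<^sub>R y)"
          using s by (intro convex_onD[OF q(1)]) auto
        finally show "q (t *\<^sub>R ((1 - s) *\<^sub>R x + s *\<^sub>R y)) / t
            \<le> (1 - s) * (q (t *\<^sub>R x) / t) + s * (q (t *\<^sub>R y) / t)"
          using t by (simp add: field_simps)
      qed simp
      show "q (t *\<^sub>R x) / t \<le> q x" for x
        using convex_onD[OF q(1), of t 0 x] t q(2) by (simp add: field_simps)
    qed (simp add: q)
    then have "q (t *\<^sub>R x) / t = q x"
      by (rule fun_cong)
    then show ?thesis
      using t by (simp add: field_simps)
  qed
  \<comment> \<open>For t > 1 the previous case is applied to the factor \<open>1 / t\<close> at the
    point \<open>t *\<^sub>R x\<close>.\<close>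
  have hom_pos: "q (t *\<^sub>R x) = t * q x" if t: "0 < t" for t x
  proof (cases "t < 1")
    case False
    show ?thesis
    proof (cases "t = 1")
      case False
      then have "q ((1 / t) *\<^sub>R (t *\<^sub>R x)) = 1 / t * q (t *\<^sub>R x)"
        using \<open>\<not> t < 1\<close> by (intro hom_lt1) auto
      then show ?thesis
        using t by (simp add: field_simps)
    qed simp
  qed (simp add: hom_lt1 t)
  have subadd: "q (x + y) \<le> q x + q y" for x y
  proof -
    have "q (x + y) = 2 * q ((1 / 2) *\<^sub>R (x + y))"
      by (simp add: hom_lt1)
    also have "\<dots> \<le> q x + q y"
      using convex_onD[OF q(1), of "1/2" x y] by (simp add: scaleR_add_right)
    finally show ?thesis .
  qed
  have add: "q (x + y) = q x + q y" for x y
  proof -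
    have "(\<lambda>x. q (x + y) - q y) = q"
    proof (rule minimal)
      show "convex_on UNIV (\<lambda>x. q (x + y) - q y)"
      proof (rule convex_onI)
        fix s :: real and x x' :: 'a
        assume s: "0 < s" "s < 1"
        have "(1 - s) *\<^sub>R x + s *\<^sub>R x' + y = (1 - s) *\<^sub>R (x + y) + s *\<^sub>R (x' + y)"
          by (simp add: algebra_simps)
        then have "q ((1 - s) *\<^sub>R x + s *\<^sub>R x' + y) \<le> (1 - s) * q (x + y) + s * q (x' + y)"
          using convex_onD[OF q(1), of s "x + y" "x' + y"] s by simp
        then show "q ((1 - s) *\<^sub>R x + s *\<^sub>R x' + y) - q y
            \<le> (1 - s) * (q (x + y) - q y) + s * (q (x' + y) - q y)"
          by (simp add: algebra_simps)
      qed simp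
    qed (use subadd in \<open>simp_all add: diff_le_eq\<close>)
    from fun_cong[OF this, of x] show ?thesis
      by simp
  qed
  have neg: "q (- x) = - q x" for x
    using add[of x "- x"] q(2) by simp
  show ?thesis
  proof (rule linearI)
    show "q (r *\<^sub>R x) = r *\<^sub>R q x" for r x
    proof (cases r "0::real" rule: linorder_cases)
      case less
      then have "q ((- r) *\<^sub>R x) = - r * q x"
        by (intro hom_pos) simp
      then show ?thesis
        using neg[of "r *\<^sub>R x"] by simp
    qed (simp_all add: q hom_pos)
  qed (rule add)
qed

text \<open>A form of the Hahn-Banach theorem: minimal elements in the set of convex functions below
  \<open>p\<close> are linear, so no subspaces have to be extended.\<close>

theorem ex_linear_le_convex:
  fixes p :: "'a::real_vector \<Rightarrow> real"
  assumes p: "convex_on UNIV p" "p 0 = 0"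
  obtains m where "linear m" "\<And>x. m x \<le> p x"
proof -
  define A where "A = {q. convex_on UNIV q \<and> q 0 = 0 \<and> (\<forall>x. q x \<le> p x)}"
  \<comment> \<open>The order is reversed: a maximal element for \<open>R\<close> is a pointwise
    minimal function.\<close>
  define R where "R q r \<longleftrightarrow> (\<forall>x. r x \<le> q x)" for q r :: "'a \<Rightarrow> real"
  \<comment> \<open>This bound does not depend on \<open>q\<close>, so pointwise infima over chains
    are finite.\<close>
  have lower: "- p (- x) \<le> q x" if "q \<in> A" for q x
    using convex_on_minus_le[of q x] that unfolding A_def
    by (auto intro: order_trans[rotated])
  have "\<exists>m\<in>A. \<forall>a\<in>A. R m a \<longrightarrow> a = m"
  proof (rule predicate_Zorn)
    show "partial_order_on A (relation_of R A)"
      by (intro partial_order_on_relation_ofI) (auto simp: R_def fun_eq_iff intro: order_trans antisym)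
    fix C
    assume C: "C \<in> Chains (relation_of R A)"
    then have CA: "C \<subseteq> A"
      by (auto simp: Chains_def relation_of_def)
    have total: "R a c \<or> R c a" if "a \<in> C" "c \<in> C" for a c
      using C that by (auto simp: Chains_def relation_of_def)
    show "\<exists>u\<in>A. \<forall>a\<in>C. R a u"
    proof (cases "C = {}")
      case True
      then show ?thesis
        using p by (auto simp: A_def)
    next
      case False
      define u where "u x = (INF a\<in>C. a x)" for x
      have bdd: "bdd_below ((\<lambda>a. a x) ` C)" for x
        using lower CA by (intro bdd_belowI[of _ "- p (- x)"]) auto
      have u_le: "u x \<le> a x" if "a \<in> C" for a x
        unfolding u_def by (rule cINF_lower[OF bdd that])
      have "convex_on UNIV u"
      proof (rule convex_onI)
        fix t :: real and x y :: 'a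
        assume t: "0 < t" "t < 1"
        show "u ((1 - t) *\<^sub>R x + t *\<^sub>R y) \<le> (1 - t) * u x + t * u y"
        proof (rule field_le_epsilon)
          fix e :: real
          assume "e > 0"
          obtain a where a: "a \<in> C" "a x < u x + e"
            using \<open>e > 0\<close> cInf_lessD[of "(\<lambda>a. a x) ` C" "u x + e"] False
            by (auto simp: u_def)
          obtain c where c: "c \<in> C" "c y < u y + e"
            using \<open>e > 0\<close> cInf_lessD[of "(\<lambda>a. a y) ` C" "u y + e"] False
            by (auto simp: u_def)
          \<comment> \<open>An infimum of convex functions need not be convex. Here the chain is
            totally ordered, so the smaller of \<open>a\<close> and \<open>c\<close> is nearly
            minimal at both points at once.\<close>
          obtain d where d: "d \<in> C" "d x \<le> a x" "d y \<le> c y"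
            using total[OF a(1) c(1)] a(1) c(1) by (auto simp: R_def)
          have "u ((1 - t) *\<^sub>R x + t *\<^sub>R y) \<le> d ((1 - t) *\<^sub>R x + t *\<^sub>R y)"
            by (rule u_le[OF d(1)])
          also have "\<dots> \<le> (1 - t) * d x + t * d y"
            using d(1) CA t by (intro convex_onD[of UNIV]) (auto simp: A_def)
          also have "\<dots> \<le> (1 - t) * (u x + e) + t * (u y + e)"
            using a c d t by (intro add_mono mult_left_mono) auto
          finally show "u ((1 - t) *\<^sub>R x + t *\<^sub>R y) \<le> (1 - t) * u x + t * u y + e"
            by (simp add: algebra_simps)
        qed
      qed simp
      moreover have "u 0 = (INF a\<in>C. 0)"
        unfolding u_def using CA by (intro INF_cong) (auto simp: A_def)
      moreover obtain a where "a \<in> C"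
        using False by blast
      then have "u x \<le> p x" for x
        using u_le[of a x] CA by (auto simp: A_def intro: order_trans)
      ultimately have "u \<in> A"
        using False by (simp add: A_def)
      then show ?thesis
        using u_le by (auto simp: R_def)
    qed
  qed
  then obtain m where m: "m \<in> A" "\<And>a. a \<in> A \<Longrightarrow> R m a \<Longrightarrow> a = m"
    by blast
  have "linear m"
  proof (rule linear_minimal_convex)
    fix r :: "'a \<Rightarrow> real"
    assume "convex_on UNIV r" "r 0 = 0" "\<And>x. r x \<le> m x"
    then show "r = m"
      using m(1) by (intro m(2)) (auto simp: A_def R_def intro: order_trans)
  qed (use m in \<open>auto simp: A_def\<close>)
  moreover have "m x \<le> p x" for x
    using m(1) by (simp add: A_def)
  ultimately show ?thesis
    by (rule that)
qed

lemma bounded_linear_if_le_norm: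
  fixes m :: "'a::real_normed_vector \<Rightarrow> real"
  assumes "linear m" and "\<And>x. m x \<le> C * norm x"
  shows "bounded_linear m"
proof -
  have "\<bar>m x\<bar> \<le> norm x * C" for x
    using assms(2)[of x] assms(2)[of "- x"] linear_neg[OF assms(1), of x]
    by (simp add: mult.commute abs_le_iff)
  then show ?thesis
    using assms(1) by (intro bounded_linear_intro[of _ C])
      (auto simp: linear_add linear_scale)
qed

text \<open>After moving \<open>x\<close> to the origin, the linear minorant of
  \<open>g (x + z) - g x\<close> is the subgradient. The Lipschitz constant bounds it, which makes
  it an element of the dual.\<close>

lemma convex_subgradient:
  fixes g :: "'a::real_normed_vector \<Rightarrow> real"
  assumes g: "convex_on UNIV g" and lip: "L-lipschitz_on UNIV g"
  obtains w :: "'a dual" where "\<And>z. g x + w (z - x) \<le> g z"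
proof -
  have "convex_on UNIV (\<lambda>z. g (x + z) - g x)"
  proof (rule convex_onI)
    fix t :: real and y z :: 'a
    assume t: "0 < t" "t < 1"
    have "x + ((1 - t) *\<^sub>R y + t *\<^sub>R z) = (1 - t) *\<^sub>R (x + y) + t *\<^sub>R (x + z)"
      by (simp add: algebra_simps)
    then have "g (x + ((1 - t) *\<^sub>R y + t *\<^sub>R z)) \<le> (1 - t) * g (x + y) + t * g (x + z)"
      using convex_onD[OF g, of t "x + y" "x + z"] t by simp
    then show "g (x + ((1 - t) *\<^sub>R y + t *\<^sub>R z)) - g x
        \<le> (1 - t) * (g (x + y) - g x) + t * (g (x + z) - g x)"
      by (simp add: algebra_simps)
  qed simp
  then obtain m where m: "linear m" "\<And>z. m z \<le> g (x + z) - g x"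
    by (rule ex_linear_le_convex) auto
  have "m z \<le> L * norm z" for z
    using m(2)[of z] lipschitz_onD[OF lip, of "x + z" x] by (simp add: dist_norm)
  then have "bounded_linear m"
    by (rule bounded_linear_if_le_norm[OF m(1)])
  then have "g x + Blinfun m (z - x) \<le> g z" for z
    using m(2)[of "z - x"] by (simp add: bounded_linear_Blinfun_apply)
  then show ?thesis
    by (rule that)
qed

section \<open>Distance functions and products of reflexive spaces\<close>

lemma convex_on_infdist:
  fixes S :: "'a::real_normed_vector set"
  assumes "convex S" "S \<noteq> {}"
  shows "convex_on UNIV (\<lambda>x. infdist x S)"
proof (rule convex_onI)
  fix t :: real and x y :: 'a
  assume t: "0 < t" "t < 1"
  show "infdist ((1 - t) *\<^sub>R x + t *\<^sub>R y) S \<le> (1 - t) * infdist x S + t * infdist y S"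
  proof (rule field_le_epsilon)
    fix e :: real
    assume e: "e > 0"
    \<comment> \<open>Nearly nearest points are used because nearest ones need not exist; their
      convex combination stays in \<open>S\<close> and competes in the infimum.\<close>
    have "\<exists>a\<in>S. dist z a < infdist z S + e" for z
      using cInf_lessD[of "(dist z) ` S" "infdist z S + e"] assms(2) e
      by (auto simp: infdist_def)
    then obtain a c where a: "a \<in> S" "dist x a < infdist x S + e"
      and c: "c \<in> S" "dist y c < infdist y S + e"
      by meson
    have "infdist ((1 - t) *\<^sub>R x + t *\<^sub>R y) S
        \<le> dist ((1 - t) *\<^sub>R x + t *\<^sub>R y) ((1 - t) *\<^sub>R a + t *\<^sub>R c)"
      using assms(1) a c t by (intro infdist_le) (auto simp: convex_def)
    also have "\<dots> = norm ((1 - t) *\<^sub>R (x - a) + t *\<^sub>R (y - c))"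
      by (simp add: dist_norm algebra_simps)
    also have "\<dots> \<le> (1 - t) * dist x a + t * dist y c"
      using norm_triangle_ineq[of "(1 - t) *\<^sub>R (x - a)" "t *\<^sub>R (y - c)"] t
      by (simp add: dist_norm)
    also have "\<dots> \<le> (1 - t) * (infdist x S + e) + t * (infdist y S + e)"
      using a c t by (intro add_mono mult_left_mono) auto
    finally show "infdist ((1 - t) *\<^sub>R x + t *\<^sub>R y) S
        \<le> (1 - t) * infdist x S + t * infdist y S + e"
      by (simp add: algebra_simps)
  qed
qed simp

text \<open>A functional on the product is the sum of its restrictions to the two axes. Hence an
  element of the bidual is determined by its values on functionals that factor through a projection,
  and these define elements of the two biduals.\<close>

lemma reflexive_space_prod:
  assumes "reflexive_space TYPE('a::real_normed_vector)"
    and "reflexive_space TYPE('b::real_normed_vector)"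
  shows "reflexive_space TYPE('a \<times> 'b)"
  unfolding reflexive_space_def surj_def
proof
  fix \<Phi> :: "('a \<times> 'b) dual dual"
  define F :: "('a \<times> 'b) \<Rightarrow>\<^sub>L 'a" where "F = Blinfun fst"
  define S :: "('a \<times> 'b) \<Rightarrow>\<^sub>L 'b" where "S = Blinfun snd"
  have [simp]: "F z = fst z" "S z = snd z" for z
    by (simp_all add: F_def S_def bounded_linear_Blinfun_apply bounded_linear_fst bounded_linear_snd)
  define \<Phi>1 :: "'a dual dual" where "\<Phi>1 = Blinfun (\<lambda>\<phi>. \<Phi> (\<phi> o\<^sub>L F))"
  define \<Phi>2 :: "'b dual dual" where "\<Phi>2 = Blinfun (\<lambda>\<psi>. \<Phi> (\<psi> o\<^sub>L S))"
  have \<Phi>1: "\<Phi>1 \<phi> = \<Phi> (\<phi> o\<^sub>L F)" for \<phi>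
    unfolding \<Phi>1_def by (subst bounded_linear_Blinfun_apply) (auto intro!: bounded_linear_intros)
  have \<Phi>2: "\<Phi>2 \<psi> = \<Phi> (\<psi> o\<^sub>L S)" for \<psi>
    unfolding \<Phi>2_def by (subst bounded_linear_Blinfun_apply) (auto intro!: bounded_linear_intros)
  obtain x where x: "\<Phi>1 = blinfun.prod_left x"
    using assms(1) unfolding reflexive_space_def surj_def by blast
  obtain y where y: "\<Phi>2 = blinfun.prod_left y"
    using assms(2) unfolding reflexive_space_def surj_def by blast
  have "\<Phi> \<eta> = \<eta> (x, y)" for \<eta>
  proof -
    define \<phi> where "\<phi> = Blinfun (\<lambda>a. \<eta> (a, 0))"
    define \<psi> where "\<psi> = Blinfun (\<lambda>c. \<eta> (0, c))"
    have \<phi>: "\<phi> a = \<eta> (a, 0)" for a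
      unfolding \<phi>_def
      by (subst bounded_linear_Blinfun_apply)
        (auto intro!: bounded_linear_intros bounded_linear_Pair)
    have \<psi>: "\<psi> c = \<eta> (0, c)" for c
      unfolding \<psi>_def
      by (subst bounded_linear_Blinfun_apply)
        (auto intro!: bounded_linear_intros bounded_linear_Pair)
    have split: "\<eta> z = \<phi> (fst z) + \<psi> (snd z)" for z
      by (cases z) (simp add: \<phi> \<psi> flip: blinfun.add_right)
    then have "\<eta> = (\<phi> o\<^sub>L F) + (\<psi> o\<^sub>L S)"
      by (intro blinfun_eqI) (simp add: blinfun.add_left)
    then have "\<Phi> \<eta> = \<Phi>1 \<phi> + \<Phi>2 \<psi>"
      by (simp add: blinfun.add_right \<Phi>1 \<Phi>2)
    then show ?thesis
      using split[of "(x, y)"] by (simp add: x y)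
  qed
  then have "\<Phi> = blinfun.prod_left (x, y)"
    by (intro blinfun_eqI) simp
  then show "\<exists>z. \<Phi> = blinfun.prod_left z"
    by blast
qed

section \<open>Monotone equilibrium problems in reflexive spaces\<close>

text \<open>This takes the place of a weak compactness argument. The unknown stands in the second
  argument of \<open>F\<close>, where convexity makes it accessible to continuous linear
  functionals.\<close>

theorem monotone_equilibrium_minty:
  fixes F :: "'a::real_normed_vector \<Rightarrow> 'a \<Rightarrow> real"
  assumes refl: "reflexive_space TYPE('a)"
    and K: "K \<noteq> {}" "closed K" "convex K" "bounded K"
    and conv: "\<And>y. y \<in> K \<Longrightarrow> convex_on UNIV (F y)"
    and lip: "\<And>y. y \<in> K \<Longrightarrow> \<exists>L. L-lipschitz_on UNIV (F y)"
    and mono: "\<And>x y. x \<in> K \<Longrightarrow> y \<in> K \<Longrightarrow> F x y + F y x \<le> 0"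
  obtains x where "x \<in> K" "\<And>y. y \<in> K \<Longrightarrow> F y x \<le> 0"
proof -
  \<comment> \<open>\<open>q w\<close> below is the infimum, over nonnegative combinations \<open>L\<close> of the functions \<open>F y\<close>, of
    \<open>sup (w - L)\<close> on \<open>K\<close>. A linear functional below \<open>q\<close> which is evaluation at \<open>x\<close> then satisfies
    \<open>F y x \<le> 0\<close>, as is seen by taking for \<open>w\<close> the subgradient of \<open>F y\<close> at \<open>x\<close>.\<close>
  define adm where "adm w s I t \<longleftrightarrow> finite I \<and> I \<subseteq> K \<and> (\<forall>y. 0 \<le> t y)
      \<and> (\<forall>y. y \<notin> I \<longrightarrow> t y = 0) \<and> (\<forall>x\<in>K. w x - (\<Sum>y\<in>I. t y * F y x) \<le> s)"
    for w :: "'a dual" and s :: real and I and t :: "'a \<Rightarrow> real"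
  define S where "S w = {s. \<exists>I t. adm w s I t}" for w
  define q where "q w = Inf (S w)" for w
  obtain R where R: "\<And>x. x \<in> K \<Longrightarrow> norm x \<le> R"
    using K(4) by (auto simp: bounded_iff)
  have wR: "\<bar>w x\<bar> \<le> R * norm w" if "x \<in> K" for w :: "'a dual" and x
    using norm_blinfun[of w x] mult_left_mono[OF R[OF that] norm_ge_zero[of w]]
    by (simp add: mult.commute)
  \<comment> \<open>A nonnegative combination of the functions \<open>F y\<close> cannot be positive
    on all of \<open>K\<close>: at the barycentre of its own nodes, weighted by its own
    coefficients, convexity and monotonicity make it nonpositive.\<close>
  have S0: "0 \<le> s" if s: "s \<in> S 0" for s
  proof -
    obtain I t where "adm 0 s I t"
      using s by (auto simp: S_def)
    then have I: "finite I" "I \<subseteq> K" and t: "\<And>y. 0 \<le> t y"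
      and s: "\<And>x. x \<in> K \<Longrightarrow> - (\<Sum>y\<in>I. t y * F y x) \<le> s"
      by (simp_all add: adm_def)
    define T where "T = sum t I"
    have "T \<ge> 0"
      unfolding T_def by (simp add: sum_nonneg t)
    show ?thesis
    proof (cases "T = 0")
      case True
      then have "t y = 0" if "y \<in> I" for y
        using that I(1) t by (simp add: T_def sum_nonneg_eq_0_iff)
      then show ?thesis
        using s K(1) by fastforce
    next
      case False
      then have T: "T > 0"
        using \<open>T \<ge> 0\<close> by simp
      then have "I \<noteq> {}"
        by (auto simp: T_def)
      have sum1: "(\<Sum>j\<in>I. t j / T) = 1"
        using T by (simp add: T_def flip: sum_divide_distrib)
      define c where "c = (\<Sum>j\<in>I. (t j / T) *\<^sub>R j)"
      have "c \<in> K"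
        unfolding c_def using I K(3) sum1 t T by (intro convex_sum) auto
      have "(\<Sum>i\<in>I. t i * F i c) \<le> (\<Sum>i\<in>I. t i * (\<Sum>j\<in>I. t j / T * F i j))"
        unfolding c_def using I \<open>I \<noteq> {}\<close> sum1 t T
        by (intro sum_mono mult_left_mono convex_on_sum[of I UNIV "F _"] conv) auto
      also have "\<dots> = (\<Sum>i\<in>I. \<Sum>j\<in>I. t i * t j / T * F i j)"
        by (simp add: sum_distrib_left mult.assoc)
      also have "\<dots> \<le> 0"
      proof -
        define D where "D = (\<Sum>i\<in>I. \<Sum>j\<in>I. t i * t j / T * F i j)"
        \<comment> \<open>Exchanging the indices symmetrises the double sum, since monotonicity
          controls only \<open>F i j + F j i\<close>.\<close>
        have "D = (\<Sum>i\<in>I. \<Sum>j\<in>I. t i * t j / T * F j i)"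
          unfolding D_def by (subst sum.swap) (simp add: mult.commute)
        then have "D + D = (\<Sum>i\<in>I. \<Sum>j\<in>I. t i * t j / T * (F i j + F j i))"
          unfolding D_def by (simp add: sum.distrib distrib_left)
        also have "\<dots> \<le> 0"
          using I t T by (intro sum_nonpos mult_nonneg_nonpos mono) auto
        finally show ?thesis
          by (simp add: D_def)
      qed
      finally show ?thesis
        using s[OF \<open>c \<in> K\<close>] by linarith
    qed
  qed
  \<comment> \<open>On \<open>K\<close> the functional \<open>w\<close> is at least
    \<open>- (R * norm w)\<close>, so raising \<open>s\<close> by \<open>R * norm w\<close> gives an
    admissible bound for the zero functional.\<close>
  have S_lower: "- (R * norm w) \<le> s" if s: "s \<in> S w" for s w
  proof -
    obtain I t where a: "adm w s I t"
      using s by (auto simp: S_def)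
    have "0 - (\<Sum>y\<in>I. t y * F y x) \<le> s + R * norm w" if "x \<in> K" for x
    proof -
      have "w x - (\<Sum>y\<in>I. t y * F y x) \<le> s"
        using a that by (simp add: adm_def)
      then show ?thesis
        using wR[OF that, of w] by linarith
    qed
    then have "adm 0 (s + R * norm w) I t"
      using a by (simp add: adm_def)
    then have "s + R * norm w \<in> S 0"
      unfolding S_def by blast
    from S0[OF this] show ?thesis
      by simp
  qed
  then have bdd: "bdd_below (S w)" for w
    by (meson bdd_belowI)
  have q_le: "q w \<le> s" if "s \<in> S w" for w s
    unfolding q_def using that bdd by (rule cInf_lower)
  \<comment> \<open>The empty combination is admissible, so every upper bound of \<open>w\<close> on
    \<open>K\<close> lies in \<open>S w\<close>.\<close>
  have S_sup: "s \<in> S w" if "\<And>x. x \<in> K \<Longrightarrow> w x \<le> s" for w :: "'a dual" and s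
    unfolding S_def adm_def using that by (auto intro!: exI[of _ "{}"] exI[of _ "\<lambda>_. 0"])
  have S_ne: "S w \<noteq> {}" for w
    using S_sup[of w "R * norm w"] wR[of _ w] by (auto simp: abs_le_iff)
  have "q 0 = 0"
    using q_le[OF S_sup[of 0 0]] S_ne[of 0] S0 unfolding q_def
    by (intro antisym cInf_greatest) auto
  moreover have "convex_on UNIV q"
  proof (rule convex_onI)
    fix a :: real and w v
    assume a: "0 < a" "a < 1"
    show "q ((1 - a) *\<^sub>R w + a *\<^sub>R v) \<le> (1 - a) * q w + a * q v"
    proof (rule field_le_epsilon)
      fix e :: real
      assume e: "e > 0"
      obtain r where r: "r \<in> S w" "r < q w + e"
        using cInf_lessD[OF S_ne, of w "q w + e"] e by (auto simp: q_def)
      obtain s where s: "s \<in> S v" "s < q v + e"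
        using cInf_lessD[OF S_ne, of v "q v + e"] e by (auto simp: q_def)
      obtain I t where I: "adm w r I t"
        using r(1) by (auto simp: S_def)
      obtain I' t' where I': "adm v s I' t'"
        using s(1) by (auto simp: S_def)
      \<comment> \<open>Both combinations are rewritten over one index set; their coefficients
        vanish outside \<open>I\<close> and \<open>I'\<close>, so no sum changes.\<close>
      define U where "U = I \<union> I'"
      define T where "T y = (1 - a) * t y + a * t' y" for y
      have U: "finite U" "U \<subseteq> K" "I \<subseteq> U" "I' \<subseteq> U"
        using I I' by (auto simp: U_def adm_def)
      have "((1 - a) *\<^sub>R w + a *\<^sub>R v) x - (\<Sum>y\<in>U. T y * F y x) \<le> (1 - a) * r + a * s"
        if x: "x \<in> K" for x
      proof -
        have 1: "(\<Sum>y\<in>I. t y * F y x) = (\<Sum>y\<in>U. t y * F y x)"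
          using U I by (intro sum.mono_neutral_left) (auto simp: adm_def)
        have 2: "(\<Sum>y\<in>I'. t' y * F y x) = (\<Sum>y\<in>U. t' y * F y x)"
          using U I' by (intro sum.mono_neutral_left) (auto simp: adm_def)
        have "(\<Sum>y\<in>U. T y * F y x)
            = (1 - a) * (\<Sum>y\<in>I. t y * F y x) + a * (\<Sum>y\<in>I'. t' y * F y x)"
          unfolding 1 2 T_def
          by (simp add: sum_distrib_left sum.distrib distrib_right mult.assoc)
        then have "((1 - a) *\<^sub>R w + a *\<^sub>R v) x - (\<Sum>y\<in>U. T y * F y x)
            = (1 - a) * (w x - (\<Sum>y\<in>I. t y * F y x)) + a * (v x - (\<Sum>y\<in>I'. t' y * F y x))"
          by (simp add: blinfun.add_left blinfun.diff_left blinfun.scaleR_left algebra_simps)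
        also have "\<dots> \<le> (1 - a) * r + a * s"
          using I I' x a by (intro add_mono mult_left_mono) (auto simp: adm_def)
        finally show ?thesis .
      qed
      then have "adm ((1 - a) *\<^sub>R w + a *\<^sub>R v) ((1 - a) * r + a * s) U T"
        using U I I' a by (auto simp: adm_def T_def U_def)
      then have "q ((1 - a) *\<^sub>R w + a *\<^sub>R v) \<le> (1 - a) * r + a * s"
        by (intro q_le) (auto simp: S_def)
      also have "\<dots> \<le> (1 - a) * (q w + e) + a * (q v + e)"
        using r s a by (intro add_mono mult_left_mono) auto
      finally show "q ((1 - a) *\<^sub>R w + a *\<^sub>R v) \<le> (1 - a) * q w + a * q v + e"
        by (simp add: algebra_simps)
    qed
  qed simp
  ultimately obtain m where m: "linear m" "\<And>w. m w \<le> q w"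
    using ex_linear_le_convex[of q] by blast
  have m_le: "m w \<le> s" if "s \<in> S w" for w s
    using m(2)[of w] q_le[OF that] by linarith
  have "m w \<le> R * norm w" for w
    using wR[of _ w] by (intro m_le S_sup) (auto simp: abs_le_iff)
  then have "bounded_linear m"
    by (rule bounded_linear_if_le_norm[OF m(1)])
  moreover obtain x where "Blinfun m = blinfun.prod_left x"
    using refl unfolding reflexive_space_def surj_def by blast
  ultimately have x: "m w = w x" for w
    by (metis bounded_linear_Blinfun_apply blinfun.prod_left.rep_eq)
  \<comment> \<open>A subgradient \<open>w\<close> of the distance to \<open>K\<close> at
    \<open>x\<close> separates: on \<open>K\<close> it is at most \<open>w x - infdist x K\<close>,
    hence so is \<open>m w\<close>. But \<open>m w = w x\<close>, so the distance is zero.\<close>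
  have "x \<in> K"
  proof -
    obtain w :: "'a dual" where w: "\<And>z. infdist x K + w (z - x) \<le> infdist z K"
      by (rule convex_subgradient[of "\<lambda>z. infdist z K" 1 x])
        (use K convex_on_infdist in \<open>auto intro!: lipschitz_onI simp: infdist_triangle_abs dist_real_def\<close>)
    have "w z \<le> w x - infdist x K" if "z \<in> K" for z
      using w[of z] that by (simp add: blinfun.diff_right)
    then have "m w \<le> w x - infdist x K"
      by (intro m_le S_sup)
    then have "infdist x K = 0"
      using infdist_nonneg[of x K] by (simp add: x)
    then show ?thesis
      using K in_closed_iff_infdist_zero by blast
  qed
  moreover have "F y x \<le> 0" if y: "y \<in> K" for y
  proof -
    obtain L where L: "L-lipschitz_on UNIV (F y)"
      using lip[OF y] by blast
    obtain w :: "'a dual" where w: "\<And>z. F y x + w (z - x) \<le> F y z"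
      by (rule convex_subgradient[OF conv[OF y] L, of x]) blast
    have "adm w (w x - F y x) {y} (\<lambda>z. if z = y then 1 else 0)"
      using w y by (auto simp: adm_def blinfun.diff_right algebra_simps)
    then have "m w \<le> w x - F y x"
      by (intro m_le) (auto simp: S_def)
    then show ?thesis
      by (simp add: x)
  qed
  ultimately show ?thesis
    by (rule that)
qed

section \<open>The Clarke derivative of a locally Lipschitz function\<close>

lemma clarke_deriv_lessD:
  assumes "clarke_deriv J x z < ereal a"
  obtains d where "d > 0"
    "\<And>t y. 0 < t \<Longrightarrow> t < d \<Longrightarrow> dist y x < d \<Longrightarrow> (J (y + t *\<^sub>R z) - J y) / t < a"
proof -
  have "eventually (\<lambda>(t, y). (J (y + t *\<^sub>R z) - J y) / t < a) (at_right 0 \<times>\<^sub>F nhds x)"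
    using Limsup_lessD[OF assms[unfolded clarke_deriv_def]] by (simp add: case_prod_unfold)
  then obtain P Q where P: "eventually P (at_right 0)" and Q: "eventually Q (nhds x)"
    and PQ: "\<And>t y. P t \<Longrightarrow> Q y \<Longrightarrow> (J (y + t *\<^sub>R z) - J y) / t < a"
    unfolding eventually_prod_filter by auto
  obtain d1 where d1: "d1 > 0" "\<And>t. 0 < t \<Longrightarrow> t < d1 \<Longrightarrow> P t"
    using P unfolding eventually_at_right_field by auto
  obtain d2 where d2: "d2 > 0" "\<And>y. dist y x < d2 \<Longrightarrow> Q y"
    using Q unfolding eventually_nhds_metric by auto
  show ?thesis
    by (rule that[of "min d1 d2"]) (use d1 d2 PQ in auto)
qed

lemma clarke_deriv_leI:
  assumes "d > 0"
    and "\<And>t y. 0 < t \<Longrightarrow> t < d \<Longrightarrow> dist y x < d \<Longrightarrow> (J (y + t *\<^sub>R z) - J y) / t \<le> a"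
  shows "clarke_deriv J x z \<le> ereal a"
  unfolding clarke_deriv_def
proof (rule Limsup_bounded)
  show "eventually (\<lambda>p. (case p of (t, y) \<Rightarrow> ereal ((J (y + t *\<^sub>R z) - J y) / t)) \<le> ereal a)
      (at_right 0 \<times>\<^sub>F nhds x)"
    unfolding eventually_prod_filter
  proof (intro exI conjI allI impI)
    show "eventually (\<lambda>t. 0 < t \<and> t < d) (at_right 0)"
      unfolding eventually_at_right_field using assms(1) by auto
    show "eventually (\<lambda>y. dist y x < d) (nhds x)"
      unfolding eventually_nhds_metric using assms(1) by auto
  qed (use assms(2) in auto)
qed

lemma clarke_deriv_geI:
  assumes "d > 0"
    and "\<And>t y. 0 < t \<Longrightarrow> t < d \<Longrightarrow> dist y x < d \<Longrightarrow> a \<le> (J (y + t *\<^sub>R z) - J y) / t"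
  shows "ereal a \<le> clarke_deriv J x z"
  unfolding clarke_deriv_def
proof (rule le_Limsup)
  show "at_right (0::real) \<times>\<^sub>F nhds x \<noteq> bot"
    by (simp add: prod_filter_eq_bot)
  show "eventually (\<lambda>p. ereal a \<le> (case p of (t, y) \<Rightarrow> ereal ((J (y + t *\<^sub>R z) - J y) / t)))
      (at_right 0 \<times>\<^sub>F nhds x)"
    unfolding eventually_prod_filter
  proof (intro exI conjI allI impI)
    show "eventually (\<lambda>t. 0 < t \<and> t < d) (at_right 0)"
      unfolding eventually_at_right_field using assms(1) by auto
    show "eventually (\<lambda>y. dist y x < d) (nhds x)"
      unfolding eventually_nhds_metric using assms(1) by auto
  qed (use assms(2) in auto)
qed

text \<open>A real-valued version for arithmetic; for locally Lipschitz \<open>J\<close> it loses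
  nothing, by \<open>ereal_clarke\<close>.\<close>

definition clarke :: "('x::real_normed_vector \<Rightarrow> real) \<Rightarrow> 'x \<Rightarrow> 'x \<Rightarrow> real" where
  "clarke J x z = real_of_ereal (clarke_deriv J x z)"

context
  fixes J :: "'x::real_normed_vector \<Rightarrow> real"
  assumes J: "locally_lipschitz J"
begin

text \<open>Near \<open>x\<close> all difference quotients are bounded by a local Lipschitz constant
  times \<open>norm z\<close>. The admissible step size depends on \<open>z\<close> but
  \<open>L\<close> does not, which later makes the derivative Lipschitz in the direction.\<close>

lemma clarke_deriv_bounds:
  obtains L where "L \<ge> 0"
    "\<And>z. clarke_deriv J x z \<le> ereal (L * norm z)" "\<And>z. ereal (- (L * norm z)) \<le> clarke_deriv J x z"
proof -
  obtain r L where r: "r > 0" and L: "L-lipschitz_on (ball x r) J"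
    using J unfolding locally_lipschitz_def by blast
  have "\<exists>d>0. \<forall>t y. 0 < t \<longrightarrow> t < d \<longrightarrow> dist y x < d \<longrightarrow> \<bar>(J (y + t *\<^sub>R z) - J y) / t\<bar> \<le> L * norm z"
    for z
  proof (intro exI conjI allI impI)
    \<comment> \<open>Half of the radius is reserved for \<open>y\<close> and half for the
      displacement \<open>t *\<^sub>R z\<close>; the added 1 covers \<open>z = 0\<close>.\<close>
    define d where "d = min (r / 2) (r / (2 * (norm z + 1)))"
    have pos: "norm z + 1 > 0"
      by (simp add: add_nonneg_pos)
    then show "d > 0"
      using r by (simp add: d_def)
    fix t y
    assume t: "0 < t" "t < d" and y: "dist y x < d"
    have "t * norm z \<le> t * (norm z + 1)"
      using t by simp
    also have "\<dots> < r / 2"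
      using t pos by (simp add: d_def field_simps)
    finally have tz: "t * norm z < r / 2" .
    have "dist x (y + t *\<^sub>R z) \<le> dist y x + norm (t *\<^sub>R z)"
      using norm_triangle_ineq[of "y - x" "t *\<^sub>R z"]
      by (simp add: dist_norm norm_minus_commute algebra_simps)
    also have "\<dots> < r"
      using tz t y by (simp add: d_def)
    finally have "y + t *\<^sub>R z \<in> ball x r"
      by simp
    moreover have "y \<in> ball x r"
      using y r by (simp add: d_def dist_commute)
    ultimately have "dist (J (y + t *\<^sub>R z)) (J y) \<le> L * dist (y + t *\<^sub>R z) y"
      by (rule lipschitz_onD[OF L])
    then show "\<bar>(J (y + t *\<^sub>R z) - J y) / t\<bar> \<le> L * norm z"
      using t by (simp add: dist_norm field_simps)
  qed
  then obtain d where d: "\<And>z. d z > 0" "\<And>z t y. 0 < t \<Longrightarrow> t < d z \<Longrightarrow> dist y x < d z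
      \<Longrightarrow> \<bar>(J (y + t *\<^sub>R z) - J y) / t\<bar> \<le> L * norm z"
    by metis
  show ?thesis
  proof (rule that)
    show "L \<ge> 0"
      using L by (rule lipschitz_on_nonneg)
    show "clarke_deriv J x z \<le> ereal (L * norm z)" for z
      by (rule clarke_deriv_leI[OF d(1)[of z]]) (rule abs_le_D1[OF d(2)])
    show "ereal (- (L * norm z)) \<le> clarke_deriv J x z" for z
      by (rule clarke_deriv_geI[OF d(1)[of z]])
        (use abs_le_D2[OF d(2)] in \<open>simp add: minus_le_iff\<close>)
  qed
qed

lemma ereal_clarke: "clarke_deriv J x z = ereal (clarke J x z)"
proof -
  obtain L where "clarke_deriv J x z \<le> ereal (L * norm z)"
    "ereal (- (L * norm z)) \<le> clarke_deriv J x z"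
    by (rule clarke_deriv_bounds[of x]) blast
  then show ?thesis
    unfolding clarke_def by (cases "clarke_deriv J x z") auto
qed

lemma clarke_le_norm:
  obtains L where "L \<ge> 0" "\<And>z. clarke J x z \<le> L * norm z"
  by (rule clarke_deriv_bounds[of x]) (auto simp: ereal_clarke)

text \<open>The quotient in direction \<open>z + z'\<close> splits at the intermediate point
  \<open>y + t *\<^sub>R z'\<close>. That point is still close to \<open>x\<close>, and the upper
  limit allows the base point to move.\<close>

lemma clarke_add_le: "clarke J x (z + z') \<le> clarke J x z + clarke J x z'"
proof (rule field_le_epsilon)
  fix e :: real
  assume e: "e > 0"
  have "clarke_deriv J x z < ereal (clarke J x z + e / 2)"
    using e by (simp add: ereal_clarke)
  then obtain d where d: "d > 0" "\<And>t y. 0 < t \<Longrightarrow> t < d \<Longrightarrow> dist y x < d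
      \<Longrightarrow> (J (y + t *\<^sub>R z) - J y) / t < clarke J x z + e / 2"
    by (rule clarke_deriv_lessD) blast
  have "clarke_deriv J x z' < ereal (clarke J x z' + e / 2)"
    using e by (simp add: ereal_clarke)
  then obtain d' where d': "d' > 0" "\<And>t y. 0 < t \<Longrightarrow> t < d' \<Longrightarrow> dist y x < d'
      \<Longrightarrow> (J (y + t *\<^sub>R z') - J y) / t < clarke J x z' + e / 2"
    by (rule clarke_deriv_lessD) blast
  define c where "c = Min {d, d', d / 2, d / (2 * (norm z' + 1))}"
  have pos: "norm z' + 1 > 0"
    by (simp add: add_nonneg_pos)
  have "clarke_deriv J x (z + z') \<le> ereal (clarke J x z + clarke J x z' + e)"
  proof (rule clarke_deriv_leI)
    show "c > 0"
      using d d' pos by (simp add: c_def)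
    fix t y
    assume t: "0 < t" "t < c" and y: "dist y x < c"
    have "t * norm z' \<le> t * (norm z' + 1)"
      using t by simp
    also have "\<dots> < d / 2"
      using t pos by (simp add: c_def field_simps)
    finally have tz: "t * norm z' < d / 2" .
    have "dist (y + t *\<^sub>R z') x \<le> dist y x + norm (t *\<^sub>R z')"
      using norm_triangle_ineq[of "y - x" "t *\<^sub>R z'"]
      by (simp add: dist_norm algebra_simps)
    also have "\<dots> < d"
      using tz t y by (simp add: c_def)
    finally have "(J (y + t *\<^sub>R z' + t *\<^sub>R z) - J (y + t *\<^sub>R z')) / t < clarke J x z + e / 2"
      using t by (intro d) (auto simp: c_def)
    moreover have "(J (y + t *\<^sub>R z') - J y) / t < clarke J x z' + e / 2"
      using t y by (intro d') (auto simp: c_def)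
    moreover have "(J (y + t *\<^sub>R (z + z')) - J y) / t
        = (J (y + t *\<^sub>R z' + t *\<^sub>R z) - J (y + t *\<^sub>R z')) / t + (J (y + t *\<^sub>R z') - J y) / t"
      by (simp add: algebra_simps flip: add_divide_distrib)
    ultimately show "(J (y + t *\<^sub>R (z + z')) - J y) / t \<le> clarke J x z + clarke J x z' + e"
      by linarith
  qed
  then show "clarke J x (z + z') \<le> clarke J x z + clarke J x z' + e"
    by (simp add: ereal_clarke)
qed

lemma clarke_zero [simp]: "clarke J x 0 = 0"
proof -
  obtain L where "clarke J x 0 \<le> L * norm (0::'x)"
    by (rule clarke_le_norm[of x]) blast
  then show ?thesis
    using clarke_add_le[of x 0 0] by simp
qed

text \<open>Replacing the step \<open>t\<close> by \<open>t * c\<close> gives one inequality; the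
  other is the same inequality for the factor \<open>1 / c\<close>.\<close>

lemma clarke_scaleR:
  assumes "c \<ge> 0"
  shows "clarke J x (c *\<^sub>R z) = c * clarke J x z"
proof -
  have le: "clarke J x (c *\<^sub>R z) \<le> c * clarke J x z" if c: "c > 0" for c z
  proof (rule field_le_epsilon)
    fix e :: real
    assume e: "e > 0"
    have "clarke_deriv J x z < ereal (clarke J x z + e / c)"
      using e c by (simp add: ereal_clarke)
    then obtain d where d: "d > 0" "\<And>t y. 0 < t \<Longrightarrow> t < d \<Longrightarrow> dist y x < d
        \<Longrightarrow> (J (y + t *\<^sub>R z) - J y) / t < clarke J x z + e / c"
      by (rule clarke_deriv_lessD) blast
    have "clarke_deriv J x (c *\<^sub>R z) \<le> ereal (c * clarke J x z + e)"
    proof (rule clarke_deriv_leI)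
      show "min d (d / c) > 0"
        using d c by simp
      fix t y
      assume t: "0 < t" "t < min d (d / c)" and y: "dist y x < min d (d / c)"
      have "(J (y + (t * c) *\<^sub>R z) - J y) / (t * c) < clarke J x z + e / c"
        using t y c by (intro d) (auto simp: field_simps)
      then have "c * ((J (y + (t * c) *\<^sub>R z) - J y) / (t * c)) \<le> c * (clarke J x z + e / c)"
        using c by (intro mult_left_mono) simp_all
      then show "(J (y + t *\<^sub>R c *\<^sub>R z) - J y) / t \<le> c * clarke J x z + e"
        using c by (simp add: distrib_left)
    qed
    then show "clarke J x (c *\<^sub>R z) \<le> c * clarke J x z + e"
      by (simp add: ereal_clarke)
  qed
  show ?thesis
  proof (cases "c = 0")
    case False
    then have c: "c > 0"
      using assms by simp
    have "clarke J x ((1 / c) *\<^sub>R c *\<^sub>R z) \<le> 1 / c * clarke J x (c *\<^sub>R z)"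
      using c by (intro le) simp
    then have "c * clarke J x z \<le> clarke J x (c *\<^sub>R z)"
      using c by (simp add: field_simps)
    then show ?thesis
      using le[OF c] by (intro antisym)
  qed simp
qed

lemma convex_on_clarke: "convex_on UNIV (clarke J x)"
proof (rule convex_onI)
  fix t :: real and y z
  assume "0 < t" "t < 1"
  then show "clarke J x ((1 - t) *\<^sub>R y + t *\<^sub>R z) \<le> (1 - t) * clarke J x y + t * clarke J x z"
    using clarke_add_le[of x "(1 - t) *\<^sub>R y" "t *\<^sub>R z"] by (simp add: clarke_scaleR)
qed simp

lemma lipschitz_clarke: "\<exists>L. L-lipschitz_on UNIV (clarke J x)"
proof -
  obtain L where L: "L \<ge> 0" "\<And>z. clarke J x z \<le> L * norm z"
    by (rule clarke_le_norm[of x]) blast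
  have "clarke J x y - clarke J x z \<le> L * norm (y - z)" for y z
    using clarke_add_le[of x "y - z" z] L(2)[of "y - z"] by simp
  then have "\<bar>clarke J x y - clarke J x z\<bar> \<le> L * norm (y - z)" for y z
    by (metis abs_le_iff minus_diff_eq norm_minus_commute)
  then have "L-lipschitz_on UNIV (clarke J x)"
    using L(1) by (intro lipschitz_onI) (auto simp: dist_norm)
  then show ?thesis ..
qed

text \<open>A bound on the quotients for base points within \<open>d\<close> of \<open>x\<close>
  also holds for base points within \<open>d / 2\<close> of any \<open>y\<close> with
  \<open>dist y x < d / 2\<close>.\<close>

lemma clarke_upper_semicontinuous:
  assumes "e > 0"
  shows "eventually (\<lambda>y. clarke J y z \<le> clarke J x z + e) (nhds x)"
proof -
  have "clarke_deriv J x z < ereal (clarke J x z + e)"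
    using assms by (simp add: ereal_clarke)
  then obtain d where d: "d > 0" "\<And>t y. 0 < t \<Longrightarrow> t < d \<Longrightarrow> dist y x < d
      \<Longrightarrow> (J (y + t *\<^sub>R z) - J y) / t < clarke J x z + e"
    by (rule clarke_deriv_lessD) blast
  have "clarke_deriv J y z \<le> ereal (clarke J x z + e)" if y: "dist y x < d / 2" for y
  proof (rule clarke_deriv_leI)
    fix t y'
    assume "0 < t" "t < d / 2" "dist y' y < d / 2"
    then show "(J (y' + t *\<^sub>R z) - J y') / t \<le> clarke J x z + e"
      using y dist_triangle[of y' x y] by (intro less_imp_le d) auto
  qed (use d in simp)
  then show ?thesis
    unfolding eventually_nhds_metric using d(1)
    by (auto simp: ereal_clarke intro!: exI[of _ "d / 2"])
qed

lemma clarke_gradient_iff: "\<xi> \<in> clarke_gradient J x \<longleftrightarrow> (\<forall>z. blinfun_apply \<xi> z \<le> clarke J x z)"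
  by (simp add: clarke_gradient_def ereal_clarke)

text \<open>A subgradient of the sublinear function \<open>clarke J x\<close> at \<open>z\<close>
  lies below it everywhere and, tested at 0, agrees with it at \<open>z\<close>. Hypotheses on the
  generalized gradient thereby become statements about directional derivatives.\<close>

lemma clarke_attained:
  obtains \<xi> where "\<xi> \<in> clarke_gradient J x" "blinfun_apply \<xi> z = clarke J x z"
proof -
  obtain L where "L-lipschitz_on UNIV (clarke J x)"
    using lipschitz_clarke by blast
  then obtain \<xi> :: "'x dual" where \<xi>: "\<And>y. clarke J x z + \<xi> (y - z) \<le> clarke J x y"
    by (rule convex_subgradient[OF convex_on_clarke]) blast
  have le: "\<xi> y \<le> clarke J x y" for y
    using \<xi>[of "y + z"] clarke_add_le[of x y z] by simp
  moreover have "\<xi> z = clarke J x z"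
    using \<xi>[of 0] le[of z] by (simp add: blinfun.minus_right)
  ultimately show ?thesis
    by (intro that) (simp_all add: clarke_gradient_iff)
qed

end

section \<open>Mixed hemivariational inequalities\<close>

lemma sublinear_translate_convex:
  fixes G :: "'a::real_vector \<Rightarrow> real"
  assumes "\<And>x y. G (x + y) \<le> G x + G y" and "\<And>c x. 0 \<le> c \<Longrightarrow> G (c *\<^sub>R x) = c * G x"
  shows "convex_on UNIV (\<lambda>x. G (x - p))"
proof (rule convex_onI)
  fix t :: real and x y :: 'a
  assume t: "0 < t" "t < 1"
  have "(1 - t) *\<^sub>R x + t *\<^sub>R y - p = (1 - t) *\<^sub>R (x - p) + t *\<^sub>R (y - p)"
    by (simp add: algebra_simps)
  then show "G ((1 - t) *\<^sub>R x + t *\<^sub>R y - p) \<le> (1 - t) * G (x - p) + t * G (y - p)"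
    using assms(1)[of "(1 - t) *\<^sub>R (x - p)" "t *\<^sub>R (y - p)"] t by (simp add: assms(2))
qed simp

lemma sublinear_translate_lipschitz:
  fixes G :: "'a::real_normed_vector \<Rightarrow> real"
  assumes "\<And>x y. G (x + y) \<le> G x + G y" and "\<And>x. G x \<le> C * norm x" and "C \<ge> 0"
  shows "C-lipschitz_on UNIV (\<lambda>x. G (x - p))"
proof (rule lipschitz_onI)
  have "G (x - p) - G (y - p) \<le> C * norm (x - y)" for x y
    using assms(1)[of "x - y" "y - p"] assms(2)[of "x - y"] by simp
  then have "\<bar>G (x - p) - G (y - p)\<bar> \<le> C * norm (x - y)" for x y
    by (metis abs_le_iff minus_diff_eq norm_minus_commute)
  then show "dist (G (x - p)) (G (y - p)) \<le> C * dist x y" for x y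
    by (simp add: dist_norm)
qed (use assms in simp)

section \<open>Interior points of balls and a priori bounds\<close>

lemma norm_add_scaleR_le:
  assumes "norm a < R"
  obtains s where "0 < s" "s \<le> 1" "\<And>t. 0 \<le> t \<Longrightarrow> t \<le> s \<Longrightarrow> norm (a + t *\<^sub>R z) \<le> R"
proof -
  define s where "s = min 1 ((R - norm a) / (norm z + 1))"
  have pos: "norm z + 1 > 0"
    by (simp add: add_nonneg_pos)
  have "norm (a + t *\<^sub>R z) \<le> R" if t: "0 \<le> t" "t \<le> s" for t
  proof -
    have "t * norm z \<le> t * (norm z + 1)"
      using t by (simp add: mult_left_mono)
    also have "\<dots> \<le> R - norm a"
      using t pos by (simp add: s_def field_simps)
    finally show ?thesis
      using norm_triangle_ineq[of a "t *\<^sub>R z"] t by simp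
  qed
  then show ?thesis
    using assms pos by (intro that[of s]) (auto simp: s_def)
qed

lemma coercive_bound:
  fixes A :: "'v::real_normed_vector \<Rightarrow> 'v dual" and \<gamma> :: "'v \<Rightarrow>\<^sub>L 'x::real_normed_vector"
  assumes coercive: "filterlim (\<lambda>v. A v v / norm v powr max \<theta> 1) at_top at_infinity"
    and "\<theta> \<ge> 0" "\<alpha> \<ge> 0" "\<beta> \<ge> 0"
  obtains C where "C \<ge> 0"
    "\<And>v. A v v \<le> norm f * norm v + \<alpha> + \<beta> * norm (\<gamma> v) powr \<theta> \<Longrightarrow> norm v \<le> C"
proof -
  \<comment> \<open>Outside the unit ball, \<open>1\<close>, \<open>norm v\<close> and
    \<open>norm v powr \<theta>\<close> are all at most \<open>P\<close>, so the assumed upper bound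
    for \<open>A v v\<close> is at most \<open>c * P\<close>. Coercivity excludes this for large
    \<open>norm v\<close>.\<close>
  define c where "c = norm f + \<alpha> + \<beta> * norm \<gamma> powr \<theta>"
  have "eventually (\<lambda>v. c < A v v / norm v powr max \<theta> 1) at_infinity"
    using coercive by (simp add: filterlim_at_top_dense)
  then obtain B where B: "\<And>v. norm v \<ge> B \<Longrightarrow> c < A v v / norm v powr max \<theta> 1"
    unfolding eventually_at_infinity by blast
  show ?thesis
  proof (rule that[of "max B 1"])
    fix v
    assume le: "A v v \<le> norm f * norm v + \<alpha> + \<beta> * norm (\<gamma> v) powr \<theta>"
    show "norm v \<le> max B 1"
    proof (rule ccontr)
      assume "\<not> norm v \<le> max B 1"
      then have v: "norm v \<ge> B" "norm v \<ge> 1"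
        by auto
      define P where "P = norm v powr max \<theta> 1"
      have P: "1 \<le> P" "norm v \<le> P" "norm v powr \<theta> \<le> P"
        using v(2) powr_mono[of 1 "max \<theta> 1" "norm v"] powr_mono[of \<theta> "max \<theta> 1" "norm v"]
        by (auto simp: P_def ge_one_powr_ge_zero)
      have "norm (\<gamma> v) powr \<theta> \<le> (norm \<gamma> * norm v) powr \<theta>"
        using assms(2) by (intro powr_mono2 norm_blinfun) auto
      also have "\<dots> \<le> norm \<gamma> powr \<theta> * P"
        using P(3) by (simp add: powr_mult mult_left_mono)
      finally have "A v v \<le> norm f * P + \<alpha> * P + \<beta> * (norm \<gamma> powr \<theta> * P)"
        using le mult_left_mono[OF P(2), of "norm f"] mult_left_mono[OF P(1), of \<alpha>]
          mult_left_mono[of "norm (\<gamma> v) powr \<theta>" "norm \<gamma> powr \<theta> * P" \<beta>] assms(3,4) by simp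
      moreover have "c * P < A v v"
        using B[OF v(1)] P(1) unfolding P_def[symmetric] by (simp add: field_simps)
      ultimately show False
        by (simp add: c_def algebra_simps)
    qed
  qed simp
qed

text \<open>A bound on the functional \<open>b v \<rho>\<close> in \<open>v\<close> becomes a bound
  on \<open>\<rho>\<close>: every quotient in the supremum is at most
  \<open>C / norm \<rho>\<close>.\<close>

lemma inf_sup_bound:
  fixes b :: "'v::real_normed_vector \<Rightarrow> 'e::real_normed_vector \<Rightarrow> real"
  assumes infsup: "(INF \<rho>\<in>UNIV - {0}. SUP v\<in>UNIV - {0}. ereal (b v \<rho> / (norm v * norm \<rho>))) \<ge> ereal \<alpha>"
    and le: "\<And>v. b v \<rho> \<le> C * norm v" and "C \<ge> 0"
  shows "\<alpha> * norm \<rho> \<le> C"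
proof (cases "\<rho> = 0")
  case False
  have "ereal \<alpha> \<le> (SUP v\<in>UNIV - {0}. ereal (b v \<rho> / (norm v * norm \<rho>)))"
    using infsup False by (simp add: le_INF_iff)
  also have "\<dots> \<le> ereal (C / norm \<rho>)"
  proof (rule SUP_least)
    fix v :: 'v
    assume "v \<in> UNIV - {0}"
    then show "ereal (b v \<rho> / (norm v * norm \<rho>)) \<le> ereal (C / norm \<rho>)"
      using le[of v] False by (simp add: field_simps)
  qed
  finally show ?thesis
    using False by (simp add: field_simps)
qed (use assms in simp)

section \<open>The mixed problem as one variational inequality on the product space\<close>

locale mixed_hvi =
  fixes A :: "'v::real_normed_vector \<Rightarrow> 'v dual"
    and J :: "'x::real_normed_vector \<Rightarrow> real"
    and \<gamma> :: "'v \<Rightarrow>\<^sub>L 'x"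
    and b :: "'v \<Rightarrow> 'e::real_normed_vector \<Rightarrow> real"
    and f :: "'v dual"
  assumes J: "locally_lipschitz J"
    and b: "bounded_bilinear b"
begin

sublocale b: bounded_bilinear b
  by (rule b)

text \<open>The left side minus the right side of the first inequality in direction
  \<open>fst z\<close>, plus the constraint term in direction \<open>snd z\<close> with its sign
  reversed.\<close>

definition form :: "'v \<times> 'e \<Rightarrow> 'v \<times> 'e \<Rightarrow> real" where
  "form p z = A (fst p) (fst z) + b (fst z) (snd p) + clarke J (\<gamma> (fst p)) (\<gamma> (fst z))
     - f (fst z) - b (fst p) (snd z)"

lemma form_zero [simp]: "form p 0 = 0"
  by (simp add: form_def blinfun.zero_right b.zero_left b.zero_right J)

lemma form_add_le: "form p (z + z') \<le> form p z + form p z'"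
  using clarke_add_le[OF J, of "\<gamma> (fst p)" "\<gamma> (fst z)" "\<gamma> (fst z')"]
  by (simp add: form_def blinfun.add_right b.add_left b.add_right)

lemma form_scaleR: "0 \<le> c \<Longrightarrow> form p (c *\<^sub>R z) = c * form p z"
  by (simp add: form_def blinfun.scaleR_right b.scaleR_left b.scaleR_right
      clarke_scaleR[OF J] algebra_simps)

lemma form_le_norm:
  obtains C where "C \<ge> 0" "\<And>z. form p z \<le> C * norm z"
proof -
  obtain L where L: "L \<ge> 0" "\<And>x. clarke J (\<gamma> (fst p)) x \<le> L * norm x"
    by (rule clarke_le_norm[OF J]) blast
  obtain B where B: "B > 0" "\<And>v e. norm (b v e) \<le> norm v * norm e * B"
    using b.pos_bounded by blast
  define C where "C = norm (A (fst p)) + norm (snd p) * B + L * norm \<gamma> + norm f + norm (fst p) * B"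
  have "form p z \<le> C * norm z" for z
  proof -
    have z: "norm (fst z) \<le> norm z" "norm (snd z) \<le> norm z"
      by (cases z; simp add: norm_fst_le norm_snd_le)+
    have app: "\<bar>g (fst z)\<bar> \<le> norm g * norm z" for g :: "'v dual"
      using norm_blinfun[of g "fst z"] mult_left_mono[OF z(1), of "norm g"] by simp
    have "norm (\<gamma> (fst z)) \<le> norm \<gamma> * norm z"
      using norm_blinfun[of \<gamma> "fst z"] mult_left_mono[OF z(1), of "norm \<gamma>"] by simp
    then have "clarke J (\<gamma> (fst p)) (\<gamma> (fst z)) \<le> L * (norm \<gamma> * norm z)"
      using L(2)[of "\<gamma> (fst z)"] mult_left_mono[of "norm (\<gamma> (fst z))" "norm \<gamma> * norm z" L] L(1)
      by linarith
    moreover have "norm (fst z) * norm (snd p) * B \<le> norm z * norm (snd p) * B"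
      using z(1) B(1) by (intro mult_right_mono) auto
    then have "b (fst z) (snd p) \<le> norm z * norm (snd p) * B"
      using B(2)[of "fst z" "snd p"] by simp
    moreover have "norm (fst p) * norm (snd z) * B \<le> norm (fst p) * norm z * B"
      using z(2) B(1) by (intro mult_right_mono mult_left_mono) auto
    then have "- b (fst p) (snd z) \<le> norm (fst p) * norm z * B"
      using B(2)[of "fst p" "snd z"] by simp
    ultimately show ?thesis
      using app[of "A (fst p)"] app[of f] by (simp add: form_def C_def algebra_simps)
  qed
  moreover have "C \<ge> 0"
    using B L by (simp add: C_def)
  ultimately show ?thesis
    using that by blast
qed

text \<open>The two components of the test direction contribute additively to \<open>form\<close>.
  The choices \<open>\<rho> = l\<close> and \<open>v = u\<close> recover the separate inequalities,
  and addition gives the joint one.\<close>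

lemma is_solution_iff:
  "is_solution A b J \<gamma> f \<Lambda> u l \<longleftrightarrow>
     l \<in> \<Lambda> \<and> (\<forall>v. \<forall>\<rho>\<in>\<Lambda>. form (u, l) ((v, \<rho>) - (u, l)) \<ge> 0)"
proof -
  have first: "ereal (f (v - u)) \<le> ereal (A u (v - u) + b (v - u) l) + clarke_deriv J (\<gamma> u) (\<gamma> v - \<gamma> u)
      \<longleftrightarrow> 0 \<le> form (u, l) ((v, l) - (u, l))" for v
    by (auto simp: form_def ereal_clarke[OF J] blinfun.diff_right b.zero_right)
  have second: "b u (\<rho> - l) \<le> 0 \<longleftrightarrow> 0 \<le> form (u, l) ((u, \<rho>) - (u, l))" for \<rho>
    by (simp add: form_def blinfun.zero_right b.zero_left J)
  have sum: "form (u, l) ((v, \<rho>) - (u, l))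
      = form (u, l) ((v, l) - (u, l)) + form (u, l) ((u, \<rho>) - (u, l))" for v \<rho>
    by (simp add: form_def blinfun.zero_right b.zero_left b.zero_right J)
  have zero: "form (u, l) ((u, l) - (u, l)) = 0"
    by simp
  have "(\<forall>v. 0 \<le> form (u, l) ((v, l) - (u, l))) \<and> (\<forall>\<rho>\<in>\<Lambda>. 0 \<le> form (u, l) ((u, \<rho>) - (u, l)))
      \<longleftrightarrow> (\<forall>v. \<forall>\<rho>\<in>\<Lambda>. 0 \<le> form (u, l) ((v, \<rho>) - (u, l)))" if "l \<in> \<Lambda>"
    using sum that zero by (metis add_0 add_0_right add_nonneg_nonneg)
  then show ?thesis
    unfolding is_solution_def first second by blast
qed

text \<open>The two contributions of \<open>b\<close> cancel in the sum, which leaves exactly the quantity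
  controlled by the relaxed monotonicity of \<open>A\<close>.\<close>

lemma form_monotone:
  assumes "\<And>u v \<xi>u \<xi>v. \<xi>u \<in> clarke_gradient J (\<gamma> u) \<Longrightarrow> \<xi>v \<in> clarke_gradient J (\<gamma> v) \<Longrightarrow>
      (A u + dual_adjoint \<gamma> \<xi>u - A v - dual_adjoint \<gamma> \<xi>v) (u - v) \<ge> h (u - v)"
  shows "form p (q - p) + form q (p - q) \<le> - h (fst p - fst q)"
proof -
  obtain u l v \<rho> where p: "p = (u, l)" and q: "q = (v, \<rho>)"
    by (meson surj_pair)
  \<comment> \<open>The gradients are chosen to attain the Clarke derivatives in exactly the
    directions that occur in \<open>form\<close>.\<close>
  obtain \<xi> where \<xi>: "\<xi> \<in> clarke_gradient J (\<gamma> u)" "\<xi> (\<gamma> (v - u)) = clarke J (\<gamma> u) (\<gamma> (v - u))"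
    by (rule clarke_attained[OF J])
  obtain \<eta> where \<eta>: "\<eta> \<in> clarke_gradient J (\<gamma> v)" "\<eta> (\<gamma> (u - v)) = clarke J (\<gamma> v) (\<gamma> (u - v))"
    by (rule clarke_attained[OF J])
  have "h (u - v) \<le> A u (u - v) + \<xi> (\<gamma> (u - v)) - A v (u - v) - \<eta> (\<gamma> (u - v))"
    using assms[OF \<xi>(1) \<eta>(1)]
    by (simp add: dual_adjoint_def blinfun.add_left blinfun.diff_left)
  then show ?thesis
    unfolding p q form_def using \<xi>(2) \<eta>(2)
    by (simp add: blinfun.diff_right b.diff_left b.diff_right)
qed

text \<open>Minty's argument: the hypothesis is used at points \<open>p t\<close> of the segment
  from \<open>x\<close> to \<open>y\<close>, and then \<open>t\<close> tends to 0 from the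
  right.\<close>

lemma minty:
  assumes A1: "\<And>w v. Limsup (at_right 0) (\<lambda>t. ereal (A (t *\<^sub>R w + (1 - t) *\<^sub>R v) (w - v)))
      \<le> ereal (A v (w - v))"
    and K: "convex K" "x \<in> K" "y \<in> K"
    and le: "\<And>p. p \<in> K \<Longrightarrow> form p (x - p) \<le> 0"
  shows "form x (y - x) \<ge> 0"
proof (rule field_le_epsilon)
  fix e :: real
  assume e: "e > 0"
  define p where "p t = x + t *\<^sub>R (y - x)" for t :: real
  have nonneg: "0 \<le> form (p t) (y - x)" if t: "0 < t" "t < 1" for t
  proof -
    have "p t = (1 - t) *\<^sub>R x + t *\<^sub>R y"
      by (simp add: p_def algebra_simps)
    then have "p t \<in> K"
      using K t by (simp add: convex_alt)
    have diff: "y - p t = (1 - t) *\<^sub>R (y - x)" "x - p t = (- t) *\<^sub>R (y - x)"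
      by (simp_all add: p_def algebra_simps)
    \<comment> \<open>Sublinearity does not control negative multiples, so 0 is written as a convex
      combination of the two opposite directions.\<close>
    have "t *\<^sub>R (y - p t) + (1 - t) *\<^sub>R (x - p t) = 0"
      by (simp add: p_def algebra_simps)
    then have "0 = form (p t) (t *\<^sub>R (y - p t) + (1 - t) *\<^sub>R (x - p t))"
      by simp
    also have "\<dots> \<le> t * form (p t) (y - p t) + (1 - t) * form (p t) (x - p t)"
      using form_add_le[of "p t" "t *\<^sub>R (y - p t)" "(1 - t) *\<^sub>R (x - p t)"] t by (simp add: form_scaleR)
    also have "\<dots> \<le> t * form (p t) (y - p t)"
      using le[OF \<open>p t \<in> K\<close>] t by (simp add: mult_nonneg_nonpos)
    also have "\<dots> = (t * (1 - t)) * form (p t) (y - x)"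
      using t by (simp add: diff form_scaleR)
    finally have "t * (1 - t) * 0 \<le> t * (1 - t) * form (p t) (y - x)"
      by simp
    then show ?thesis
      by (rule mult_left_le_imp_le) (use t in simp)
  qed
  obtain u l v \<rho> where x: "x = (u, l)" and y: "y = (v, \<rho>)"
    by (meson surj_pair)
  have lim: "(p \<longlongrightarrow> x) (at_right 0)"
    unfolding p_def by (auto intro!: tendsto_eq_intros)
  have limf: "((\<lambda>t. fst (p t)) \<longlongrightarrow> u) (at_right 0)" and lims: "((\<lambda>t. snd (p t)) \<longlongrightarrow> l) (at_right 0)"
    using tendsto_fst[OF lim] tendsto_snd[OF lim] by (simp_all add: x)
  have "Limsup (at_right 0) (\<lambda>t. ereal (A (fst (p t)) (v - u))) \<le> ereal (A u (v - u))"
  proof -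
    have "fst (p t) = t *\<^sub>R v + (1 - t) *\<^sub>R u" for t
      by (simp add: p_def x y algebra_simps)
    then show ?thesis
      using A1[of v u] by simp
  qed
  also have "\<dots> < ereal (A u (v - u) + e / 4)"
    using e by simp
  finally have evA: "eventually (\<lambda>t. A (fst (p t)) (v - u) < A u (v - u) + e / 4) (at_right 0)"
    by (auto dest: Limsup_lessD)
  have "((\<lambda>t. \<gamma> (fst (p t))) \<longlongrightarrow> \<gamma> u) (at_right 0)"
    by (intro blinfun.tendsto tendsto_const limf)
  then have evJ: "eventually (\<lambda>t. clarke J (\<gamma> (fst (p t))) (\<gamma> (v - u))
      \<le> clarke J (\<gamma> u) (\<gamma> (v - u)) + e / 4) (at_right 0)"
    using clarke_upper_semicontinuous[OF J, of "e / 4" "\<gamma> (v - u)" "\<gamma> u"] e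
    by (auto simp: filterlim_iff)
  have "((\<lambda>t. b (v - u) (snd (p t))) \<longlongrightarrow> b (v - u) l) (at_right 0)"
    by (intro b.tendsto tendsto_const lims)
  then have evb: "eventually (\<lambda>t. b (v - u) (snd (p t)) < b (v - u) l + e / 4) (at_right 0)"
    using e by (intro order_tendstoD(2)) auto
  have "((\<lambda>t. b (fst (p t)) (\<rho> - l)) \<longlongrightarrow> b u (\<rho> - l)) (at_right 0)"
    by (intro b.tendsto tendsto_const limf)
  then have evb': "eventually (\<lambda>t. b u (\<rho> - l) - e / 4 < b (fst (p t)) (\<rho> - l)) (at_right 0)"
    using e by (intro order_tendstoD(1)) auto
  have ev1: "eventually (\<lambda>t::real. 0 < t \<and> t < 1) (at_right 0)"
    unfolding eventually_at_right_field by (auto intro: exI[of _ 1])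
  \<comment> \<open>Four terms of \<open>form\<close> depend on the base point, and each costs at
    most \<open>e / 4\<close>; the term with \<open>f\<close> is constant.\<close>
  have "eventually (\<lambda>t. 0 \<le> form x (y - x) + e) (at_right (0::real))"
    using evA evJ evb evb' ev1
  proof eventually_elim
    case (elim t)
    then have "0 \<le> form (p t) (y - x)"
      by (intro nonneg) auto
    then show ?case
      using elim by (simp add: form_def x y)
  qed
  then show "0 \<le> form x (y - x) + e"
    by simp
qed

end

section \<open>Existence of a solution and uniqueness of its first component\<close>

theorem theorem15:
  fixes A :: "'v::banach \<Rightarrow> 'v dual"
    and J :: "'x::banach \<Rightarrow> real"
    and h :: "'v \<Rightarrow> real"
    and \<gamma> :: "'v \<Rightarrow>\<^sub>L 'x"
    and b :: "'v \<Rightarrow> 'e::banach \<Rightarrow> real"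
    and f :: "'v dual"
    and \<Lambda> :: "'e set"
    and \<theta> \<alpha>\<^sub>J \<beta>\<^sub>J \<alpha>\<^sub>b :: real
  assumes reflV: "reflexive_space TYPE('v)"
    and reflE: "reflexive_space TYPE('e)"
    and \<Lambda>: "\<Lambda> \<noteq> {}" "closed \<Lambda>" "convex \<Lambda>" "0 \<in> \<Lambda>"
    and A1: "\<And>w v. Limsup (at_right 0)
               (\<lambda>t. ereal (blinfun_apply (A (t *\<^sub>R w + (1 - t) *\<^sub>R v)) (w - v)))
             \<le> ereal (blinfun_apply (A v) (w - v))"
    and A2: "\<And>u v \<xi>u \<xi>v. \<xi>u \<in> clarke_gradient J (blinfun_apply \<gamma> u) \<Longrightarrow>
               \<xi>v \<in> clarke_gradient J (blinfun_apply \<gamma> v) \<Longrightarrow>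
               blinfun_apply (A u + dual_adjoint \<gamma> \<xi>u - A v - dual_adjoint \<gamma> \<xi>v) (u - v)
                 \<ge> h (u - v)"
    and A3: "filterlim (\<lambda>v. blinfun_apply (A v) v / norm v powr max \<theta> 1) at_top at_infinity"
    and A4: "\<And>B. bounded B \<Longrightarrow> bounded (A ` B)"
    and J1: "locally_lipschitz J"
    and J2: "\<theta> \<ge> 0" "\<alpha>\<^sub>J \<ge> 0" "\<beta>\<^sub>J > 0"
            "\<And>x. clarke_deriv J x (- x) \<le> ereal (\<alpha>\<^sub>J + \<beta>\<^sub>J * norm x powr \<theta>)"
    and J3: "\<And>B. bounded B \<Longrightarrow> bounded (\<Union>x\<in>B. clarke_gradient J x)"
    and h0: "h 0 = 0"
    and h1: "\<And>v. Limsup (at_right 0) (\<lambda>t. ereal (h (t *\<^sub>R v) / t)) \<ge> 0"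
    and h2: "\<And>vn v. weakly_tendsto vn v \<Longrightarrow> ereal (h v) \<le> limsup (\<lambda>n. ereal (h (vn n)))"
    and h3: "\<And>v. v \<noteq> 0 \<Longrightarrow> h v > 0"
    and b_bounded: "bounded_bilinear b"
    and b_infsup: "\<alpha>\<^sub>b > 0"
            "(INF \<rho>\<in>UNIV - {0}. SUP v\<in>UNIV - {0}. ereal (b v \<rho> / (norm v * norm \<rho>))) \<ge> ereal \<alpha>\<^sub>b"
  shows "(\<exists>u l. is_solution A b J \<gamma> f \<Lambda> u l) \<and>
         (\<forall>u1 l1 u2 l2. is_solution A b J \<gamma> f \<Lambda> u1 l1 \<longrightarrow> is_solution A b J \<gamma> f \<Lambda> u2 l2 \<longrightarrow> u1 = u2)"
proof -
  interpret mixed_hvi A J \<gamma> b f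
    by (rule mixed_hvi.intro[OF J1 b_bounded])
  have mono: "form p (q - p) + form q (p - q) \<le> - h (fst p - fst q)" for p q
    by (rule form_monotone[OF A2])
  have h_nonneg: "0 \<le> h v" for v
    using h0 h3[of v] by (cases "v = 0") auto

  \<comment> \<open>Each solution is tested with the other; the sum of the two inequalities bounds
    \<open>h (u1 - u2)\<close> by 0.\<close>
  have unique: "u1 = u2"
    if "is_solution A b J \<gamma> f \<Lambda> u1 l1" "is_solution A b J \<gamma> f \<Lambda> u2 l2" for u1 l1 u2 l2
  proof -
    have "0 \<le> form (u1, l1) ((u2, l2) - (u1, l1))" "0 \<le> form (u2, l2) ((u1, l1) - (u2, l2))"
      using that by (auto simp: is_solution_iff)
    then have "h (u1 - u2) \<le> 0"
      using mono[of "(u1, l1)" "(u2, l2)"] by simp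
    then show ?thesis
      using h3[of "u1 - u2"] by force
  qed

  \<comment> \<open>\<open>C\<close> and the constant \<open>D\<close> below depend only on the
    data, so the radius \<open>R\<close> of the truncation can be chosen after them.\<close>
  obtain C where C: "C \<ge> 0"
    "\<And>v. A v v \<le> norm f * norm v + \<alpha>\<^sub>J + \<beta>\<^sub>J * norm (\<gamma> v) powr \<theta> \<Longrightarrow> norm v \<le> C"
    by (rule coercive_bound[OF A3 J2(1,2) less_imp_le[OF J2(3)], where f = f and \<gamma> = \<gamma>]) blast
  obtain M where M: "\<And>v. norm v \<le> C \<Longrightarrow> norm (A v) \<le> M"
    using A4[OF bounded_cball[of 0 C]] unfolding bounded_iff by (metis imageI mem_cball_0)
  have "bounded (\<Union>x\<in>\<gamma> ` cball 0 C. clarke_gradient J x)"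
    by (intro J3 bounded_linear_image bounded_cball blinfun.bounded_linear_right)
  then obtain M' where M': "\<And>v \<xi>. norm v \<le> C \<Longrightarrow> \<xi> \<in> clarke_gradient J (\<gamma> v) \<Longrightarrow> norm \<xi> \<le> M'"
    unfolding bounded_iff by (metis UN_I imageI mem_cball_0)
  define D where "D = M + M' * norm \<gamma> + norm f"
  have bound: "- A v z + clarke J (\<gamma> v) (\<gamma> (- z)) + f z \<le> D * norm z" if v: "norm v \<le> C" for v z
  proof -
    obtain \<xi> where \<xi>: "\<xi> \<in> clarke_gradient J (\<gamma> v)" "\<xi> (\<gamma> (- z)) = clarke J (\<gamma> v) (\<gamma> (- z))"
      by (rule clarke_attained[OF J1])
    have "norm (\<xi> (\<gamma> (- z))) \<le> norm \<xi> * norm (\<gamma> (- z))"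
      by (rule norm_blinfun)
    also have "\<dots> \<le> M' * (norm \<gamma> * norm (- z))"
      using M'[OF v \<xi>(1)] order_trans[OF norm_ge_zero M'[OF v \<xi>(1)]]
      by (intro mult_mono norm_blinfun) auto
    finally have "clarke J (\<gamma> v) (\<gamma> (- z)) \<le> M' * norm \<gamma> * norm z"
      using \<xi>(2) by simp
    moreover have "- A v z \<le> M * norm z"
      using norm_blinfun[of "A v" z] mult_right_mono[OF M[OF v], of "norm z"] by simp
    moreover have "f z \<le> norm f * norm z"
      using norm_blinfun[of f z] by simp
    ultimately show ?thesis
      by (simp add: D_def algebra_simps)
  qed
  have "D \<ge> 0"
  proof -
    have "0 \<le> M"
      using order_trans[OF norm_ge_zero M[of 0]] C(1) by simp
    moreover obtain \<xi> where "\<xi> \<in> clarke_gradient J (\<gamma> 0)"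
      by (rule clarke_attained[OF J1])
    then have "0 \<le> M'"
      using order_trans[OF norm_ge_zero M'[of 0 \<xi>]] C(1) by simp
    ultimately show ?thesis
      by (simp add: D_def)
  qed
  \<comment> \<open>\<open>R\<close> strictly exceeds the bounds to be shown for \<open>u\<close>
    and \<open>l\<close>, so that neither truncating ball is active.\<close>
  define R where "R = max C (D / \<alpha>\<^sub>b) + 1"
  have R: "C < R" "D / \<alpha>\<^sub>b < R" "0 < R"
    using C(1) by (auto simp: R_def)

  define K where "K = cball (0::'v) R \<times> (\<Lambda> \<inter> cball 0 R)"
  have "0 \<in> K"
    using \<Lambda>(4) R(3) by (simp add: K_def zero_prod_def)
  have K: "K \<noteq> {}" "closed K" "convex K" "bounded K"
    using \<open>0 \<in> K\<close> \<Lambda> unfolding K_def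
    by (auto intro!: closed_Times convex_Times convex_Int bounded_Times bounded_Int)
  obtain p where "p \<in> K" and Minty: "\<And>q. q \<in> K \<Longrightarrow> form q (p - q) \<le> 0"
  proof (rule monotone_equilibrium_minty[where F = "\<lambda>q x. form q (x - q)",
        OF reflexive_space_prod[OF reflV reflE] K])
    show "convex_on UNIV (\<lambda>x. form q (x - q))" for q
      by (intro sublinear_translate_convex form_add_le form_scaleR)
    show "\<exists>L. L-lipschitz_on UNIV (\<lambda>x. form q (x - q))" for q
    proof -
      obtain L where "L \<ge> 0" "\<And>z. form q z \<le> L * norm z"
        by (rule form_le_norm[of q]) blast
      then show ?thesis
        by (intro exI sublinear_translate_lipschitz form_add_le)
    qed
    show "form x (y - x) + form y (x - y) \<le> 0" for x y
      using mono[of x y] h_nonneg[of "fst x - fst y"] by linarith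
  qed blast
  obtain u l where p: "p = (u, l)"
    by (meson surj_pair)
  have l: "l \<in> \<Lambda>"
    using \<open>p \<in> K\<close> by (simp add: K_def p)
  have Stampacchia: "0 \<le> form p (q - p)" if "q \<in> K" for q
    using minty[OF A1 K(3) \<open>p \<in> K\<close> that Minty] .

  have "norm u \<le> C"
  proof (rule C(2))
    have "clarke J (\<gamma> u) (- \<gamma> u) \<le> \<alpha>\<^sub>J + \<beta>\<^sub>J * norm (\<gamma> u) powr \<theta>"
      using J2(4)[of "\<gamma> u"] by (simp add: ereal_clarke[OF J1])
    moreover have "f u \<le> norm f * norm u"
      using norm_blinfun[of f u] by simp
    \<comment> \<open>In the test with the origin the two terms \<open>b u l\<close> cancel.\<close>
    moreover have "0 \<le> - A u u + clarke J (\<gamma> u) (- \<gamma> u) + f u"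
      using Stampacchia[OF \<open>0 \<in> K\<close>]
      by (simp add: p form_def blinfun.minus_right b.minus_left b.minus_right)
    ultimately show "A u u \<le> norm f * norm u + \<alpha>\<^sub>J + \<beta>\<^sub>J * norm (\<gamma> u) powr \<theta>"
      by linarith
  qed
  then have "norm u < R"
    using R(1) by simp
  have "\<alpha>\<^sub>b * norm l \<le> D"
  proof (rule inf_sup_bound[OF b_infsup(2) _ \<open>D \<ge> 0\<close>])
    fix z
    \<comment> \<open>Only the first component moves, by a step short enough to stay in
      \<open>K\<close>; homogeneity then removes \<open>s\<close>.\<close>
    obtain s where s: "0 < s" "norm (u + s *\<^sub>R (- z)) \<le> R"
      by (rule norm_add_scaleR_le[OF \<open>norm u < R\<close>, of "- z"]) auto
    then have "(u + s *\<^sub>R (- z), l) \<in> K"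
      using \<open>p \<in> K\<close> by (simp add: K_def p)
    then have "0 \<le> form p (s *\<^sub>R (- z, 0))"
      using Stampacchia by (fastforce simp: p)
    then have "0 \<le> form p (- z, 0)"
      using s(1) by (subst (asm) form_scaleR) (auto simp: zero_le_mult_iff)
    then have "b z l \<le> - A u z + clarke J (\<gamma> u) (\<gamma> (- z)) + f z"
      by (simp add: p form_def blinfun.minus_right b.minus_left b.zero_right)
    also have "\<dots> \<le> D * norm z"
      by (rule bound[OF \<open>norm u \<le> C\<close>])
    finally show "b z l \<le> D * norm z" .
  qed
  then have "norm l \<le> D / \<alpha>\<^sub>b"
    using b_infsup(1) by (simp add: field_simps)
  then have "norm l < R"
    using R(2) by simp

  \<comment> \<open>A short step from \<open>p\<close> towards an arbitrary
    \<open>(v, \<rho>)\<close> stays in \<open>K\<close>, by interiority and convexity of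
    \<open>\<Lambda>\<close>. Homogeneity rescales the resulting inequality to the full
    step.\<close>
  have "0 \<le> form p ((v, \<rho>) - p)" if \<rho>: "\<rho> \<in> \<Lambda>" for v \<rho>
  proof -
    obtain s where s: "0 < s" "s \<le> 1" "\<And>t. 0 \<le> t \<Longrightarrow> t \<le> s \<Longrightarrow> norm (u + t *\<^sub>R (v - u)) \<le> R"
      by (rule norm_add_scaleR_le[OF \<open>norm u < R\<close>, of "v - u"]) blast
    obtain s' where s': "0 < s'" "s' \<le> 1" "\<And>t. 0 \<le> t \<Longrightarrow> t \<le> s' \<Longrightarrow> norm (l + t *\<^sub>R (\<rho> - l)) \<le> R"
      by (rule norm_add_scaleR_le[OF \<open>norm l < R\<close>, of "\<rho> - l"]) blast
    define t where "t = min s s'"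
    have t: "0 < t" "t \<le> 1" "t \<le> s" "t \<le> s'"
      using s s' by (auto simp: t_def)
    have "l + t *\<^sub>R (\<rho> - l) = (1 - t) *\<^sub>R l + t *\<^sub>R \<rho>"
      by (simp add: algebra_simps)
    then have "l + t *\<^sub>R (\<rho> - l) \<in> \<Lambda>"
      using \<Lambda>(3) l \<rho> t by (simp add: convex_alt)
    then have "(u + t *\<^sub>R (v - u), l + t *\<^sub>R (\<rho> - l)) \<in> K"
      using s(3) s'(3) t by (simp add: K_def)
    then have "0 \<le> form p (t *\<^sub>R ((v, \<rho>) - p))"
      using Stampacchia by (fastforce simp: p)
    then show ?thesis
      using t(1) by (subst (asm) form_scaleR) (auto simp: zero_le_mult_iff)
  qed
  then have "is_solution A b J \<gamma> f \<Lambda> u l"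
    using l by (simp add: is_solution_iff p)
  then show ?thesis
    using unique by blast
qed

end
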